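(* Let $n$ be a positive integer and $q$ a prime power, both fixed, and let $m(n) = \left[\frac{n^2}{4}\right] + 1$. For a positive integer $k$, let $c(n,k,q)$ be the number of orbits of $GL_n(\mathbb{F}_q)$, acting by simultaneous conjugation $g\cdot(A_1,\ldots,A_k) = (gA_1g^{-1},\ldots,gA_kg^{-1})$, on the set $$M_n(\mathbb{F}_q)^{(k)} = \{(A_1,\ldots,A_k)\in M_n(\mathbb{F}_q)^k : A_iA_j = A_jA_i \text{ for all } i\neq j\}.$$ Then $c(n,k,q)$, as a function of $k$, is asymptotic to $q^{m(n)k}$ up to a constant factor: there exist constants $C_1, C_2 > 0$ (independent of $k$) such that $C_1 q^{m(n)k} \le c(n,k,q) \le C_2 q^{m(n)k}$ for all sufficiently large $k$.
   Context: $\mathbb{F}_q$ is the finite field with $q$ elements, $M_n(\mathbb{F}_q)$ the algebra of $n\times n$ matrices over it, $GL_n(\mathbb{F}_q)$ its group of units, and $[x]$ denotes the integer part of $x$. (The number $m(n)$ is the maximal dimension of a commutative subalgebra of $M_n(\mathbb{F}_q)$.) *)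

theory Defs
  imports Complex_Main "HOL-Library.Cardinality" "HOL-Algebra.Group_Action" "Jordan_Normal_Form.Matrix"
begin

definition GL :: "'a :: field itself \<Rightarrow> nat \<Rightarrow> 'a mat monoid" where
  "GL ty n = units_of (ring_mat ty n ())"

text \<open>A \<open>k\<close>-tuple of matrices is a list of length \<open>k\<close>, so indices run from \<open>0\<close> to \<open>k - 1\<close>.\<close>

definition commuting_tuples :: "'a :: field itself \<Rightarrow> nat \<Rightarrow> nat \<Rightarrow> 'a mat list set" where
  "commuting_tuples ty n k =
     {As. length As = k \<and> set As \<subseteq> carrier_mat n n \<and>
          (\<forall>i<k. \<forall>j<k. i \<noteq> j \<longrightarrow> As ! i * As ! j = As ! j * As ! i)}"

text \<open>The restriction to the set of commuting tuples makes this map extensional, as the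
  locale \<open>group_action\<close> requires; it does not affect the orbits.\<close>

definition sim_conj ::
    "'a :: field itself \<Rightarrow> nat \<Rightarrow> nat \<Rightarrow> 'a mat \<Rightarrow> 'a mat list \<Rightarrow> 'a mat list" where
  "sim_conj ty n k g =
     (\<lambda>As \<in> commuting_tuples ty n k. map (\<lambda>A. g * A * inv\<^bsub>GL ty n\<^esub> g) As)"

definition num_orbits :: "'a :: field itself \<Rightarrow> nat \<Rightarrow> nat \<Rightarrow> nat" where
  "num_orbits ty n k = card (orbits (GL ty n) (commuting_tuples ty n k) (sim_conj ty n k))"

definition schur_dim :: "nat \<Rightarrow> nat" where
  "schur_dim n = n\<^sup>2 div 4 + 1"

lemma group_GL: "group (GL (ty :: 'a :: field itself) n)"
proof -
  interpret semiring "ring_mat TYPE('a) n ()" by (rule semiring_mat)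
  have "ring_mat ty n () = ring_mat TYPE('a) n ()" by (simp add: ring_mat_def)
  then show ?thesis unfolding GL_def using units_group by simp
qed

lemma carrier_GL: "g \<in> carrier (GL ty n) \<Longrightarrow> g \<in> carrier_mat n n"
  by (auto simp: GL_def units_of_def Units_def ring_mat_simps)

lemma mult_GL: "(\<otimes>\<^bsub>GL ty n\<^esub>) = (*)"
  by (simp add: GL_def units_of_def ring_mat_simps)

lemma one_GL: "one (GL ty n) = 1\<^sub>m n"
  by (simp add: GL_def units_of_def ring_mat_simps)

lemma inv_GL:
  assumes "g \<in> carrier (GL ty n)"
  shows "inv\<^bsub>GL ty n\<^esub> g \<in> carrier_mat n n" "inv\<^bsub>GL ty n\<^esub> g * g = 1\<^sub>m n"
    "g * inv\<^bsub>GL ty n\<^esub> g = 1\<^sub>m n"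
  using group.inv_closed[OF group_GL assms] group.l_inv[OF group_GL assms]
    group.r_inv[OF group_GL assms]
  by (auto simp: mult_GL one_GL intro: carrier_GL)

lemma conj_mult:
  assumes "g \<in> carrier (GL ty n)" "A \<in> carrier_mat n n" "B \<in> carrier_mat n n"
  shows "(g * A * inv\<^bsub>GL ty n\<^esub> g) * (g * B * inv\<^bsub>GL ty n\<^esub> g) = g * (A * B) * inv\<^bsub>GL ty n\<^esub> g"
proof -
  define h where "h = inv\<^bsub>GL ty n\<^esub> g"
  note c = carrier_GL[OF assms(1)] inv_GL(1)[OF assms(1), folded h_def] assms(2,3)
  have "(g * A * h) * (g * B * h) = g * A * ((h * g) * (B * h))"
    using c by (simp add: assoc_mult_mat[of _ n n _ n _ n])
  also have "\<dots> = g * (A * B) * h"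
    using c inv_GL(2)[OF assms(1), folded h_def]
    by (simp add: assoc_mult_mat[of _ n n _ n _ n])
  finally show ?thesis by (simp add: h_def)
qed

lemma sim_conj_closed:
  assumes "g \<in> carrier (GL ty n)" "As \<in> commuting_tuples ty n k"
  shows "sim_conj ty n k g As \<in> commuting_tuples ty n k"
proof -
  have c: "As ! i \<in> carrier_mat n n" if "i < k" for i
    using assms(2) that by (auto simp: commuting_tuples_def)
  show ?thesis
    using assms c inv_GL(1)[OF assms(1)] carrier_GL[OF assms(1)]
    by (auto simp: sim_conj_def commuting_tuples_def conj_mult)
qed

lemma sim_conj_comp:
  assumes g: "g \<in> carrier (GL ty n)" and h: "h \<in> carrier (GL ty n)"
    and As: "As \<in> commuting_tuples ty n k"
  shows "sim_conj ty n k (g \<otimes>\<^bsub>GL ty n\<^esub> h) As = sim_conj ty n k g (sim_conj ty n k h As)"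
proof -
  have i: "inv\<^bsub>GL ty n\<^esub> (g * h) = inv\<^bsub>GL ty n\<^esub> h * inv\<^bsub>GL ty n\<^esub> g"
    using group.inv_mult_group[OF group_GL g h] by (simp add: mult_GL)
  note c = carrier_GL[OF g] carrier_GL[OF h] inv_GL(1)[OF g] inv_GL(1)[OF h]
  have "g * h * A * inv\<^bsub>GL ty n\<^esub> (g * h) =
      g * (h * A * inv\<^bsub>GL ty n\<^esub> h) * inv\<^bsub>GL ty n\<^esub> g" if "A \<in> carrier_mat n n" for A
    using c that by (simp add: i assoc_mult_mat[of _ n n _ n _ n])
  moreover have "sim_conj ty n k h As \<in> commuting_tuples ty n k"
    by (rule sim_conj_closed[OF h As])
  ultimately show ?thesis
    using As by (auto simp: sim_conj_def mult_GL commuting_tuples_def)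
qed

lemma sim_conj_one:
  assumes As: "As \<in> commuting_tuples ty n k"
  shows "sim_conj ty n k \<one>\<^bsub>GL ty n\<^esub> As = As"
proof -
  have "inv\<^bsub>GL ty n\<^esub> (1\<^sub>m n) = 1\<^sub>m n"
    using monoid.inv_one[OF group.is_monoid[OF group_GL[of ty n]]] by (simp add: one_GL)
  then show ?thesis
    using As by (auto simp: sim_conj_def one_GL commuting_tuples_def intro!: map_idI)
qed

lemma group_action_sim_conj:
  "group_action (GL ty n) (commuting_tuples ty n k) (sim_conj ty n k)"
proof -
  let ?E = "commuting_tuples ty n k" and ?G = "GL ty n"
  interpret group ?G by (rule group_GL)
  have bij: "sim_conj ty n k g \<in> Bij ?E" if g: "g \<in> carrier ?G" for g
  proof -
    have "bij_betw (sim_conj ty n k g) ?E ?E"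
    proof (rule bij_betw_byWitness[where f' = "sim_conj ty n k (inv\<^bsub>?G\<^esub> g)"])
      show "\<forall>As\<in>?E. sim_conj ty n k (inv\<^bsub>?G\<^esub> g) (sim_conj ty n k g As) = As"
        using g by (simp add: sim_conj_comp[symmetric] sim_conj_one)
      show "\<forall>As\<in>?E. sim_conj ty n k g (sim_conj ty n k (inv\<^bsub>?G\<^esub> g) As) = As"
        using g by (simp add: sim_conj_comp[symmetric] sim_conj_one)
    qed (use g in \<open>auto simp: sim_conj_closed\<close>)
    then show ?thesis by (simp add: Bij_def sim_conj_def)
  qed
  have mult: "sim_conj ty n k (g \<otimes>\<^bsub>?G\<^esub> h) = compose ?E (sim_conj ty n k g) (sim_conj ty n k h)"
    if g: "g \<in> carrier ?G" and h: "h \<in> carrier ?G" for g h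
  proof (rule extensionalityI[of _ ?E])
    show "sim_conj ty n k (g \<otimes>\<^bsub>?G\<^esub> h) As
        = compose ?E (sim_conj ty n k g) (sim_conj ty n k h) As" if "As \<in> ?E" for As
      using sim_conj_comp[OF g h that] that by (simp add: compose_def)
  qed (simp_all add: sim_conj_def)
  show ?thesis
    by (intro group_action.intro group_hom.intro group_hom_axioms.intro homI
          group_GL group_BijGroup)
      (use bij mult in \<open>auto simp: BijGroup_def\<close>)
qed

text \<open>Over a finite field the set of commuting tuples is finite, so \<open>num_orbits\<close> is a genuine
  cardinality.\<close>

lemma finite_carrier_mat: "finite (carrier_mat n k :: 'a :: finite mat set)"
proof (rule finite_subset)
  show "(carrier_mat n k :: 'a mat set) \<subseteq> mat n k ` (({..<n} \<times> {..<k}) \<rightarrow>\<^sub>E UNIV)"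
  proof
    fix A :: "'a mat" assume A: "A \<in> carrier_mat n k"
    show "A \<in> mat n k ` (({..<n} \<times> {..<k}) \<rightarrow>\<^sub>E UNIV)"
    proof (rule image_eqI)
      show "A = mat n k (restrict (\<lambda>ij. A $$ ij) ({..<n} \<times> {..<k}))"
        by (rule eq_matI) (use A in simp_all)
      show "restrict (\<lambda>ij. A $$ ij) ({..<n} \<times> {..<k}) \<in> ({..<n} \<times> {..<k}) \<rightarrow>\<^sub>E UNIV"
        by simp
    qed
  qed
  show "finite (mat n k ` (({..<n} \<times> {..<k}) \<rightarrow>\<^sub>E (UNIV :: 'a set)))"
    by (rule finite_imageI, rule finite_PiE) simp_all
qed

lemma finite_commuting_tuples:
  "finite (commuting_tuples (ty :: 'a :: {field, finite} itself) n k)"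
  by (rule finite_subset[OF _ finite_lists_length_eq[OF finite_carrier_mat[of n n], of k]])
    (auto simp: commuting_tuples_def)

lemma finite_orbits:
  "finite (orbits (GL (ty :: 'a :: {field, finite} itself) n)
     (commuting_tuples ty n k) (sim_conj ty n k))"
  using finite_commuting_tuples[of ty n k] by (simp add: orbits_def)

end

theory Submission
  imports Defs
begin

text \<open>A commuting tuple lies in a commutative subalgebra, and there are only finitely many
  subalgebras, so the upper bound reduces to Schur's bound \<open>dim A \<le> n\<^sup>2 div 4 + 1\<close> for a
  commutative subalgebra \<open>A\<close>. Let \<open>v\<^sub>1, \<dots>, v\<^sub>s\<close> be a smallest generating set of \<open>F\<^sup>n\<close> as
  an \<open>A\<close>-module. The modules generated by initial segments increase strictly, hence
  \<open>dim (A v\<^sub>i) \<le> n - s + 1\<close>. If \<open>A\<^sub>i\<close> is the annihilator of \<open>v\<^sub>1, \<dots>, v\<^sub>i\<close>, then for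
  \<open>i \<ge> 1\<close> the space \<open>A\<^sub>i v\<^sub>i\<^sub>+\<^sub>1\<close> does not contain \<open>v\<^sub>i\<^sub>+\<^sub>1\<close>: otherwise
  \<open>a v\<^sub>i\<^sub>+\<^sub>1 = v\<^sub>i\<^sub>+\<^sub>1\<close> and \<open>a v\<^sub>1 = 0\<close> for some \<open>a\<close>, and \<open>v\<^sub>1 + v\<^sub>i\<^sub>+\<^sub>1\<close> generates both
  vectors. Since \<open>A\<close> acts faithfully, adding up the dimensions of \<open>A\<^sub>i v\<^sub>i\<^sub>+\<^sub>1\<close> gives
  \<open>dim A \<le> 1 + s (n - s)\<close>. Dimensions are replaced by cardinalities throughout. For the lower
  bound, the scalar matrices plus an off-diagonal block form a commuting set of
  \<open>q ^ (n\<^sup>2 div 4 + 1)\<close> matrices, and orbits have at most \<open>|GL\<^sub>n|\<close> elements.\<close>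

section \<open>Counting vectors and subspaces over a finite field\<close>

lemma finite_carrier_vec: "finite (carrier_vec n :: 'a :: finite vec set)"
  and card_carrier_vec: "card (carrier_vec n :: 'a :: finite vec set) = CARD('a) ^ n"
proof -
  have "bij_betw list_of_vec (carrier_vec n :: 'a vec set) {xs. set xs \<subseteq> UNIV \<and> length xs = n}"
    by (rule bij_betw_byWitness[where f' = vec_of_list])
      (auto simp: vec_list list_vec intro!: carrier_vecI)
  moreover have "finite {xs :: 'a list. set xs \<subseteq> UNIV \<and> length xs = n}"
    by (rule finite_lists_length_eq) simp
  moreover have "card {xs :: 'a list. set xs \<subseteq> UNIV \<and> length xs = n} = CARD('a) ^ n"
    by (rule card_lists_length_eq) simp
  ultimately show "finite (carrier_vec n :: 'a vec set)"
    "card (carrier_vec n :: 'a vec set) = CARD('a) ^ n"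
    by (auto simp: bij_betw_finite bij_betw_same_card)
qed

definition lin_subspace :: "nat \<Rightarrow> 'a :: field vec set \<Rightarrow> bool" where
  "lin_subspace n S \<longleftrightarrow> S \<subseteq> carrier_vec n \<and> 0\<^sub>v n \<in> S \<and>
     (\<forall>u\<in>S. \<forall>v\<in>S. u + v \<in> S) \<and> (\<forall>c. \<forall>v\<in>S. c \<cdot>\<^sub>v v \<in> S)"

text \<open>Multiplicative form of \<open>dim S + 1 <= dim T\<close> for a proper subspace: the sums
  of a multiple of \<open>t\<close> and an element of \<open>S\<close> are pairwise distinct and lie
  in \<open>T\<close>.\<close>

lemma card_lin_subspace_less:
  fixes S T :: "'a :: {field, finite} vec set"
  assumes S: "lin_subspace n S" and T: "lin_subspace n T"
    and "S \<subseteq> T" and t: "t \<in> T" "t \<notin> S"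
  shows "CARD('a) * card S \<le> card T"
proof -
  let ?f = "\<lambda>(c, s). c \<cdot>\<^sub>v t + s"
  have car: "t \<in> carrier_vec n" "\<And>s. s \<in> S \<Longrightarrow> s \<in> carrier_vec n"
    using S T t by (auto simp: lin_subspace_def)
  have "inj_on ?f (UNIV \<times> S)"
  proof (rule inj_onI, clarify)
    fix c d :: 'a and s u assume s: "s \<in> S" and u: "u \<in> S"
      and eq: "c \<cdot>\<^sub>v t + s = d \<cdot>\<^sub>v t + u"
    note cc = car(1) car(2)[OF s] car(2)[OF u]
    have coord: "c * t $ i + s $ i = d * t $ i + u $ i" if "i < n" for i
      using arg_cong[OF eq, of "\<lambda>v. v $ i"] cc that by simp
    have "c = d"
    proof (rule ccontr)
      assume "c \<noteq> d"
      \<comment> \<open>With different coefficients the equation can be solved for \<open>t\<close>,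
        which puts \<open>t\<close> into \<open>S\<close>.\<close>
      then have "t = (1 / (c - d)) \<cdot>\<^sub>v (u + (- 1) \<cdot>\<^sub>v s)"
        using cc coord by (intro eq_vecI) (auto simp: field_simps)
      also have "\<dots> \<in> S"
        using S s u unfolding lin_subspace_def by blast
      finally show False using t by simp
    qed
    moreover from this have "s = u"
      using cc coord by (intro eq_vecI) auto
    ultimately show "c = d \<and> s = u" by simp
  qed
  moreover have "?f ` (UNIV \<times> S) \<subseteq> T"
    using T t \<open>S \<subseteq> T\<close> by (auto simp: lin_subspace_def)
  moreover have "finite T"
    using T finite_subset[OF _ finite_carrier_vec] by (auto simp: lin_subspace_def)
  ultimately have "card ((UNIV :: 'a set) \<times> S) \<le> card T"
    by (rule card_inj_on_le)
  then show ?thesis by (simp add: card_cartesian_product)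
qed

section \<open>Schur's bound for commutative matrix algebras\<close>

text \<open>Closure under products is left out: Schur's bound is proved for any linear space of
  pairwise commuting matrices that contains the identity.\<close>

locale comm_mat_algebra =
  fixes n :: nat and A :: "'a :: {field, finite} mat set"
  assumes carrier: "A \<subseteq> carrier_mat n n"
    and one: "1\<^sub>m n \<in> A"
    and add: "\<And>a b. a \<in> A \<Longrightarrow> b \<in> A \<Longrightarrow> a + b \<in> A"
    and smult: "\<And>c a. a \<in> A \<Longrightarrow> c \<cdot>\<^sub>m a \<in> A"
    and comm: "\<And>a b. a \<in> A \<Longrightarrow> b \<in> A \<Longrightarrow> a * b = b * a"
begin

definition submod :: "'a vec set \<Rightarrow> bool" where
  "submod S \<longleftrightarrow> S \<subseteq> carrier_vec n \<and> 0\<^sub>v n \<in> S \<and>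
     (\<forall>u\<in>S. \<forall>v\<in>S. u + v \<in> S) \<and> (\<forall>a\<in>A. \<forall>v\<in>S. a *\<^sub>v v \<in> S)"

text \<open>For \<open>B\<close> outside \<open>carrier_vec n\<close> the intersection runs over the
  empty family and is \<open>UNIV\<close>, hence the assumption of
  \<open>submod_gen\<close>.\<close>

definition gen :: "'a vec set \<Rightarrow> 'a vec set" where
  "gen B = \<Inter>{S. submod S \<and> B \<subseteq> S}"

definition ann :: "'a vec set \<Rightarrow> 'a mat set" where
  "ann C = {a \<in> A. \<forall>v\<in>C. a *\<^sub>v v = 0\<^sub>v n}"

lemma mult_vec_carrier: "a \<in> A \<Longrightarrow> v \<in> carrier_vec n \<Longrightarrow> a *\<^sub>v v \<in> carrier_vec n"
  using carrier mult_mat_vec_carrier by blast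

lemma mult_vec_zero: "a \<in> A \<Longrightarrow> a *\<^sub>v 0\<^sub>v n = 0\<^sub>v n"
  using carrier by (auto intro!: eq_vecI)

lemma submod_carrier: "submod (carrier_vec n)"
  using carrier by (auto simp: submod_def)

lemma submod_lin_subspace:
  assumes "submod S"
  shows "lin_subspace n S"
proof -
  have "c \<cdot>\<^sub>v v \<in> S" if v: "v \<in> S" for c v
  proof -
    have "v \<in> carrier_vec n" using assms v by (auto simp: submod_def)
    then have "c \<cdot>\<^sub>v v = (c \<cdot>\<^sub>m 1\<^sub>m n) *\<^sub>v v" by (auto intro!: eq_vecI)
    moreover have "(c \<cdot>\<^sub>m 1\<^sub>m n) *\<^sub>v v \<in> S"
      using assms v smult[OF one] by (auto simp: submod_def)
    ultimately show ?thesis by simp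
  qed
  then show ?thesis using assms by (auto simp: submod_def lin_subspace_def)
qed

lemma submod_gen:
  assumes "B \<subseteq> carrier_vec n"
  shows "submod (gen B)"
  unfolding submod_def
proof (intro conjI ballI)
  show "gen B \<subseteq> carrier_vec n"
    using assms submod_carrier by (auto simp: gen_def)
qed (auto simp: gen_def submod_def)

lemma gen_superset: "B \<subseteq> gen B"
  by (auto simp: gen_def)

lemma gen_least: "submod S \<Longrightarrow> B \<subseteq> S \<Longrightarrow> gen B \<subseteq> S"
  by (auto simp: gen_def)

lemma gen_mono: "B \<subseteq> C \<Longrightarrow> gen B \<subseteq> gen C"
  by (auto simp: gen_def)

text \<open>Rank-nullity by counting: evaluation at \<open>b\<close> is linear on
  \<open>ann C\<close> with kernel \<open>ann (insert b C)\<close>, so no fibre has more elements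
  than the kernel.\<close>

lemma card_ann_insert:
  assumes b: "b \<in> carrier_vec n" and C: "C \<subseteq> carrier_vec n"
  shows "card (ann C) \<le> card (ann (insert b C)) * card ((\<lambda>a. a *\<^sub>v b) ` ann C)"
proof -
  have fin: "finite (ann C)" for C
    using carrier by (intro finite_subset[OF _ finite_carrier_mat[of n n]]) (auto simp: ann_def)
  have fibre: "card {a \<in> ann C. a *\<^sub>v b = y} \<le> card (ann (insert b C))"
    if img: "y \<in> (\<lambda>a. a *\<^sub>v b) ` ann C" for y
  proof -
    obtain e where y: "y = e *\<^sub>v b" and e: "e \<in> ann C" using img by (rule imageE)
    have eA: "e \<in> A" using e by (simp add: ann_def)
    have ec: "e \<in> carrier_mat n n" using carrier eA by auto
    show ?thesis
    \<comment> \<open>Subtracting a fixed element \<open>e\<close> of the fibre moves the fibre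
      injectively into the kernel.\<close>
    proof (rule card_inj_on_le[where f = "\<lambda>a. a - e"])
      show "inj_on (\<lambda>a. a - e) {a \<in> ann C. a *\<^sub>v b = y}"
      proof (rule inj_onI)
        fix a a' assume a: "a \<in> {a \<in> ann C. a *\<^sub>v b = y}" and a': "a' \<in> {a \<in> ann C. a *\<^sub>v b = y}"
          and eq: "a - e = a' - e"
        have cc: "a \<in> carrier_mat n n" "a' \<in> carrier_mat n n"
          using a a' carrier by (auto simp: ann_def)
        have "a $$ (i, j) = a' $$ (i, j)" if "i < n" "j < n" for i j
          using arg_cong[OF eq, of "\<lambda>m. m $$ (i, j)"] cc ec that by simp
        then show "a = a'" using cc by (intro eq_matI) auto
      qed
      show "(\<lambda>a. a - e) ` {a \<in> ann C. a *\<^sub>v b = y} \<subseteq> ann (insert b C)"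
      proof clarify
        fix a assume a: "a \<in> ann C" and yb: "y = a *\<^sub>v b"
        have aA: "a \<in> A" using a by (simp add: ann_def)
        have ac: "a \<in> carrier_mat n n" using carrier aA by auto
        have "a - e = a + (- 1) \<cdot>\<^sub>m e"
          using ac ec by (intro eq_matI) auto
        then have "a - e \<in> A" using add aA smult eA by metis
        moreover have "(a - e) *\<^sub>v v = 0\<^sub>v n" if v: "v \<in> C" for v
        proof -
          have z: "a *\<^sub>v v = 0\<^sub>v n" "e *\<^sub>v v = 0\<^sub>v n" using a e v by (auto simp: ann_def)
          have "(a - e) *\<^sub>v v = a *\<^sub>v v - e *\<^sub>v v"
            using minus_mult_distrib_mat_vec[OF ac ec] v C by auto
          then show ?thesis by (simp add: z)
        qed
        moreover have "(a - e) *\<^sub>v b = 0\<^sub>v n"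
          using minus_mult_distrib_mat_vec[OF ac ec b] yb y mult_vec_carrier[OF aA b] by simp
        ultimately show "a - e \<in> ann (insert b C)" by (simp add: ann_def)
      qed
    qed (rule fin)
  qed
  have "card (ann C) = card (\<Union>y \<in> (\<lambda>a. a *\<^sub>v b) ` ann C. {a \<in> ann C. a *\<^sub>v b = y})"
    by (rule arg_cong[where f = card]) auto
  also have "\<dots> \<le> (\<Sum>y \<in> (\<lambda>a. a *\<^sub>v b) ` ann C. card {a \<in> ann C. a *\<^sub>v b = y})"
    by (rule card_UN_le) (simp add: fin)
  also have "\<dots> \<le> (\<Sum>y \<in> (\<lambda>a. a *\<^sub>v b) ` ann C. card (ann (insert b C)))"
    by (rule sum_mono) (rule fibre)
  finally show ?thesis by (simp add: mult.commute)
qed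

lemma lin_subspace_ann_image:
  assumes b: "b \<in> carrier_vec n" and C: "C \<subseteq> carrier_vec n"
  shows "lin_subspace n ((\<lambda>a. a *\<^sub>v b) ` ann C)"
  unfolding lin_subspace_def
proof (intro conjI ballI allI)
  have A: "a \<in> carrier_mat n n" if "a \<in> A" for a using carrier that by auto
  have C': "v \<in> carrier_vec n" if "v \<in> C" for v using C that by auto
  show "(\<lambda>a. a *\<^sub>v b) ` ann C \<subseteq> carrier_vec n"
    using b by (auto simp: ann_def mult_vec_carrier)
  have "0 \<cdot>\<^sub>m 1\<^sub>m n = (0\<^sub>m n n :: 'a mat)" by (intro eq_matI) auto
  then have "0\<^sub>m n n \<in> A" using smult[OF one] by metis
  then have "0\<^sub>m n n \<in> ann C"
    using C' by (auto simp: ann_def intro!: eq_vecI)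
  moreover have "0\<^sub>m n n *\<^sub>v b = 0\<^sub>v n"
    using b by (auto intro!: eq_vecI)
  ultimately show "0\<^sub>v n \<in> (\<lambda>a. a *\<^sub>v b) ` ann C" by force
  show "u + v \<in> (\<lambda>a. a *\<^sub>v b) ` ann C"
    if uv: "u \<in> (\<lambda>a. a *\<^sub>v b) ` ann C" "v \<in> (\<lambda>a. a *\<^sub>v b) ` ann C" for u v
  proof -
    obtain a e where a: "a \<in> ann C" "u = a *\<^sub>v b" and e: "e \<in> ann C" "v = e *\<^sub>v b"
      using uv by auto
    have "a + e \<in> ann C"
      using a e add by (auto simp: ann_def add_mult_distrib_mat_vec[OF A A C'])
    moreover have "u + v = (a + e) *\<^sub>v b"
      using a e add_mult_distrib_mat_vec[OF A A b] by (simp add: ann_def)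
    ultimately show ?thesis by auto
  qed
  show "c \<cdot>\<^sub>v u \<in> (\<lambda>a. a *\<^sub>v b) ` ann C" if u: "u \<in> (\<lambda>a. a *\<^sub>v b) ` ann C" for c u
  proof -
    obtain a where a: "a \<in> ann C" "u = a *\<^sub>v b" using u by auto
    then have "a \<in> carrier_mat n n" using A by (simp add: ann_def)
    then have sm: "(c \<cdot>\<^sub>m a) *\<^sub>v v = c \<cdot>\<^sub>v (a *\<^sub>v v)" if "v \<in> carrier_vec n" for v
      using that by (intro eq_vecI) (auto simp: row_smult smult_scalar_prod_distrib[of _ n])
    have "c \<cdot>\<^sub>m a \<in> ann C"
      using a smult C' by (auto simp: ann_def sm)
    then show ?thesis using a sm[OF b] by (intro image_eqI[of _ _ "c \<cdot>\<^sub>m a"]) simp_all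
  qed
qed

text \<open>Commutativity of \<open>A\<close> enters the bound here: if \<open>a\<close> kills
  \<open>v\<close>, then it kills \<open>x *\<^sub>v v\<close> for every \<open>x\<close> in
  \<open>A\<close>.\<close>

lemma submod_kernel:
  assumes a: "a \<in> A"
  shows "submod {v \<in> carrier_vec n. a *\<^sub>v v = 0\<^sub>v n}"
proof -
  have A: "x \<in> carrier_mat n n" if "x \<in> A" for x using carrier that by auto
  have "a *\<^sub>v (x *\<^sub>v v) = x *\<^sub>v (a *\<^sub>v v)" if "x \<in> A" "v \<in> carrier_vec n" for x v
    using assoc_mult_mat_vec[OF A[OF a] A[OF that(1)] that(2)]
      assoc_mult_mat_vec[OF A[OF that(1)] A[OF a] that(2)] comm[OF a that(1)] by simp
  then show ?thesis
    using A[OF a] a by (auto simp: submod_def mult_add_distrib_mat_vec mult_vec_carrier mult_vec_zero)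
qed

text \<open>Faithfulness of the action: the kernel of \<open>a\<close> is a submodule that contains
  the generators, so \<open>a\<close> kills every unit vector and all its columns vanish.\<close>

lemma ann_generators:
  assumes "B \<subseteq> carrier_vec n" "gen B = carrier_vec n"
  shows "ann B \<subseteq> {0\<^sub>m n n}"
proof
  fix a assume a: "a \<in> ann B"
  then have aA: "a \<in> A" and ac: "a \<in> carrier_mat n n" using carrier by (auto simp: ann_def)
  have "gen B \<subseteq> {v \<in> carrier_vec n. a *\<^sub>v v = 0\<^sub>v n}"
    using a assms(1) by (intro gen_least submod_kernel[OF aA]) (auto simp: ann_def)
  then have z: "a *\<^sub>v unit_vec n j = 0\<^sub>v n" for j using assms(2) by auto
  have "a $$ (i, j) = 0" if "i < n" "j < n" for i j
    using arg_cong[OF z[of j], of "\<lambda>v. v $ i"] that ac by simp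
  then show "a \<in> {0\<^sub>m n n}" using ac by (auto intro!: eq_matI)
qed

text \<open>Multiplicative form of \<open>dim (A v) <= n - card B + 1\<close>. Starting from
  \<open>gen {v}\<close>, each of the other generators, adjoined one at a time, lies outside the
  module reached so far and multiplies its size by at least \<open>CARD('a)\<close>.\<close>

lemma card_gen_single:
  assumes B: "B \<subseteq> carrier_vec n" "finite B" and indep: "\<And>b. b \<in> B \<Longrightarrow> b \<notin> gen (B - {b})"
    and v: "v \<in> B"
  shows "card (gen {v}) * CARD('a) ^ (card B - 1) \<le> CARD('a) ^ n"
proof -
  have *: "card (gen {v}) * CARD('a) ^ card C \<le> card (gen (insert v C))"
    if "finite C" "C \<subseteq> B - {v}" for C
    using that
  proof (induction C rule: finite_induct)
    case (insert b C)
    have sub: "insert v C \<subseteq> carrier_vec n" "insert v (insert b C) \<subseteq> carrier_vec n"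
      using insert.prems B v by auto
    have "b \<notin> gen (insert v C)"
      using indep[of b] gen_mono[of "insert v C" "B - {b}"] insert v by auto
    then have "CARD('a) * card (gen (insert v C)) \<le> card (gen (insert v (insert b C)))"
      using gen_superset[of "insert v (insert b C)"]
      by (intro card_lin_subspace_less[where n = n and t = b] submod_lin_subspace submod_gen sub gen_mono) auto
    moreover have "card (gen {v}) * CARD('a) ^ card C \<le> card (gen (insert v C))"
      using insert by auto
    ultimately have "CARD('a) * (card (gen {v}) * CARD('a) ^ card C)
        \<le> card (gen (insert v (insert b C)))"
      by (meson le_trans mult_le_mono2)
    then show ?case using insert by (simp add: mult_ac)
  qed simp
  have "insert v (B - {v}) = B" using v by auto
  moreover have "gen B \<subseteq> carrier_vec n" using submod_gen[OF B(1)] by (simp add: submod_def)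
  ultimately show ?thesis
    using *[of "B - {v}"] B(2) v card_mono[OF finite_carrier_vec, of "gen B" n]
    by (auto simp: card_carrier_vec)
qed

text \<open>Applying \<open>a\<close> to \<open>v + b\<close> recovers \<open>b\<close>, so \<open>v + b\<close> can replace both generators.\<close>

lemma gen_merge:
  assumes B: "B \<subseteq> carrier_vec n" and v: "v \<in> B" and b: "b \<in> B"
    and a: "a \<in> A" "a *\<^sub>v v = 0\<^sub>v n" "a *\<^sub>v b = b"
  shows "gen B \<subseteq> gen (insert (v + b) (B - {v, b}))"
proof (rule gen_least)
  let ?S = "gen (insert (v + b) (B - {v, b}))"
  have cc: "v \<in> carrier_vec n" "b \<in> carrier_vec n" "a \<in> carrier_mat n n"
    using B v b a carrier by auto
  then show S: "submod ?S" using B by (intro submod_gen) auto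
  note lin = submod_lin_subspace[OF S]
  have w: "v + b \<in> ?S" and rest: "B - {v, b} \<subseteq> ?S"
    using gen_superset[of "insert (v + b) (B - {v, b})"] by auto
  have "a *\<^sub>v (v + b) = b"
    using a cc by (simp add: mult_add_distrib_mat_vec)
  then have bS: "b \<in> ?S" using S w a by (metis submod_def)
  have "v = (v + b) + (- 1) \<cdot>\<^sub>v b" using cc by (intro eq_vecI) auto
  also have "\<dots> \<in> ?S" using lin w bS unfolding lin_subspace_def by blast
  finally show "B \<subseteq> ?S" using bS rest by auto
qed

lemma card_le:
  assumes n: "n \<ge> 1"
  shows "card A \<le> CARD('a) ^ schur_dim n"
proof -
  let ?q = "CARD('a)"
  let ?P = "\<lambda>s. \<exists>B \<subseteq> carrier_vec n. gen B = carrier_vec n \<and> card B = s"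
  have q: "?q > 1"
    using card_mono[of UNIV "{0, 1 :: 'a}"] by simp
  define s where "s = (LEAST s. ?P s)"
  have "gen (carrier_vec n) = carrier_vec n"
    using gen_superset gen_least[OF submod_carrier] by blast
  then have "?P (card (carrier_vec n :: 'a vec set))" by blast
  then have "?P s" unfolding s_def by (rule LeastI)
  then obtain B where B: "B \<subseteq> carrier_vec n" "gen B = carrier_vec n" "card B = s" by blast
  have finB: "finite B" using B(1) finite_carrier_vec by (rule finite_subset)
  \<comment> \<open>Minimality of \<open>s\<close>: fewer than \<open>s\<close> vectors never
    generate a module containing \<open>gen B\<close>, which is the whole space.\<close>
  have min: "\<not> gen B \<subseteq> gen B'" if "B' \<subseteq> carrier_vec n" "card B' < s" for B'
  proof
    assume "gen B \<subseteq> gen B'"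
    then have "?P (card B')"
      using that(1) B(2) submod_gen[OF that(1)] by (auto simp: submod_def)
    then show False using not_less_Least[of "card B'" ?P] that(2) by (simp add: s_def)
  qed
  have indep: "b \<notin> gen (B - {b})" if b: "b \<in> B" for b
  proof
    assume "b \<in> gen (B - {b})"
    then have "gen B \<subseteq> gen (B - {b})"
      using gen_superset[of "B - {b}"] B(1) by (intro gen_least submod_gen) auto
    moreover have "card (B - {b}) < s" using card_Diff1_less[OF finB b] B(3) by simp
    ultimately show False using min[of "B - {b}"] B(1) by auto
  qed
  have single: "card (gen {b}) * ?q ^ (s - 1) \<le> ?q ^ n" if "b \<in> B" for b
    using card_gen_single[OF B(1) finB indep that] B(3) by simp
  have subm: "submod (gen {b})" if "b \<in> B" for b
    by (rule submod_gen) (use that B(1) in auto)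
  have img: "(\<lambda>a. a *\<^sub>v b) ` ann C \<subseteq> gen {b}" if "b \<in> B" for b C
    using subm[OF that] gen_superset[of "{b}"] by (auto simp: submod_def ann_def)
  have fing: "finite (gen {b})" if "b \<in> B" for b
    using subm[OF that] by (auto simp: submod_def intro: finite_subset[OF _ finite_carrier_vec])
  have "B \<noteq> {}"
  proof
    assume "B = {}"
    moreover have "submod {0\<^sub>v n}" by (auto simp: submod_def mult_vec_zero)
    ultimately have "carrier_vec n \<subseteq> {0\<^sub>v n :: 'a vec}" using gen_least B(2) by blast
    then have "unit_vec n 0 \<in> {0\<^sub>v n :: 'a vec}" by (rule subsetD) simp
    then have "unit_vec n 0 $ 0 = (0\<^sub>v n :: 'a vec) $ 0" by simp
    then show False using n by simp
  qed
  then have s: "s \<ge> 1" using card_gt_0_iff[of B] finB B(3) by auto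
  \<comment> \<open>In dimensions: \<open>dim A <= dim (ann C) + card C * (n - s) + 1\<close>. The
    extra 1 belongs to the first generator, the only one whose image may contain the generator
    itself. Since \<open>s\<close> and \<open>card C\<close> are positive, the subtraction in the
    exponent does not truncate.\<close>
  have "card A * ?q ^ (s * card C - 1) \<le> card (ann C) * ?q ^ (n * card C)"
    if "finite C" "C \<noteq> {}" "C \<subseteq> B" for C
    using that
  proof (induction C rule: finite_ne_induct)
    case (singleton v)
    then have v: "v \<in> B" by simp
    \<comment> \<open>\<open>ann {}\<close> is all of \<open>A\<close>.\<close>
    have "card (ann {}) \<le> card (ann {v}) * card ((\<lambda>a. a *\<^sub>v v) ` ann {})"
      using v B(1) by (intro card_ann_insert) auto
    also have "\<dots> \<le> card (ann {v}) * card (gen {v})"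
      by (intro mult_le_mono2 card_mono fing img v)
    finally have "card A * ?q ^ (s - 1) \<le> card (ann {v}) * card (gen {v}) * ?q ^ (s - 1)"
      by (simp add: ann_def)
    also have "\<dots> \<le> card (ann {v}) * ?q ^ n" using single[OF v] by (simp add: mult.assoc)
    finally show ?case by simp
  next
    case (insert b C)
    then have b: "b \<in> B" and C: "C \<subseteq> B" by auto
    let ?I = "(\<lambda>a. a *\<^sub>v b) ` ann C"
    obtain v where v: "v \<in> C" using insert by auto
    \<comment> \<open>Otherwise some \<open>a\<close> in \<open>ann C\<close> kills \<open>v\<close>
      and fixes \<open>b\<close>, and replacing both by \<open>v + b\<close> leaves at most
      \<open>s - 1\<close> generators.\<close>
    have "b \<notin> ?I"
    proof
      assume "b \<in> ?I"
      then obtain a where a: "a \<in> A" "a *\<^sub>v v = 0\<^sub>v n" "a *\<^sub>v b = b"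
        using v by (auto simp: ann_def)
      have "v \<noteq> b" using v insert by auto
      then have "card (B - {v, b}) = s - 2" and "s \<ge> 2"
        using b C v finB B(3) card_mono[OF finB, of "{v, b}"]
        by (auto simp: card_Diff_subset)
      moreover have "card (insert (v + b) (B - {v, b})) \<le> card (B - {v, b}) + 1"
        using finB by (simp add: card_insert_if)
      ultimately have "card (insert (v + b) (B - {v, b})) < s" by linarith
      moreover have vB: "v \<in> B" using v C by blast
      moreover have "v + b \<in> carrier_vec n" using vB b B(1) by (blast intro: add_carrier_vec)
      ultimately show False
        using gen_merge[OF B(1) vB b a] min[of "insert (v + b) (B - {v, b})"] B(1) by blast
    qed
    moreover have "b \<in> gen {b}" using gen_superset by auto
    \<comment> \<open>\<open>?I\<close> lies in \<open>gen {b}\<close> but misses \<open>b\<close>;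
      the factor gained improves the bound \<open>n - s + 1\<close> on its dimension to
      \<open>n - s\<close>.\<close>
    ultimately have "?q * card ?I \<le> card (gen {b})"
      using b C B(1) img[OF b]
      by (intro card_lin_subspace_less[where n = n and t = b] lin_subspace_ann_image
          submod_lin_subspace submod_gen) auto
    then have "?q * card ?I * ?q ^ (s - 1) \<le> ?q ^ n"
      using single[OF b] by (meson le_trans mult_le_mono1)
    then have I: "card ?I * ?q ^ s \<le> ?q ^ n"
      using s by (simp add: power_eq_if mult_ac split: if_splits)
    have exp: "s * card (insert b C) - 1 = (s * card C - 1) + s"
      using insert s by (simp add: card_gt_0_iff Suc_le_eq)
    have "card A * ?q ^ (s * card (insert b C) - 1) = (card A * ?q ^ (s * card C - 1)) * ?q ^ s"
      by (simp only: exp power_add mult.assoc)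
    also have "\<dots> \<le> (card (ann C) * ?q ^ (n * card C)) * ?q ^ s"
      using insert C by (intro mult_le_mono1) auto
    also have "\<dots> \<le> (card (ann (insert b C)) * card ?I * ?q ^ (n * card C)) * ?q ^ s"
      using b C B(1) by (intro mult_le_mono1 card_ann_insert) auto
    also have "\<dots> = card (ann (insert b C)) * ?q ^ (n * card C) * (card ?I * ?q ^ s)"
      by (simp add: mult_ac)
    also have "\<dots> \<le> card (ann (insert b C)) * ?q ^ (n * card C) * ?q ^ n"
      by (intro mult_le_mono2 I)
    also have "\<dots> = card (ann (insert b C)) * ?q ^ (n * card (insert b C))"
      using insert by (simp add: power_add mult_ac)
    finally show ?case .
  qed
  from this[OF finB \<open>B \<noteq> {}\<close>]
  have "card A * ?q ^ (s * s - 1) \<le> card (ann B) * ?q ^ (n * s)" by (simp add: B(3))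
  also have "card (ann B) \<le> 1"
    using card_mono[OF _ ann_generators[OF B(1,2)]] by simp
  then have "card (ann B) * ?q ^ (n * s) \<le> 1 * ?q ^ (n * s)" by (rule mult_le_mono1)
  finally have main: "card A * ?q ^ (s * s - 1) \<le> ?q ^ (n * s)" by simp
  \<comment> \<open>This is the nonnegativity of \<open>(n - 2 * s)^2\<close>, taken over the
    integers because \<open>n - 2 * s\<close> may be negative. Dividing by 4 bounds
    \<open>s * (n - s)\<close> by the integer part of a quarter of the square of
    \<open>n\<close>.\<close>
  have "4 * (n * s) \<le> n * n + 4 * (s * s)"
  proof -
    have "0 \<le> (int n - 2 * int s)\<^sup>2" by simp
    then have "4 * (int n * int s) \<le> int n * int n + 4 * (int s * int s)"
      by (simp add: power2_eq_square algebra_simps)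
    then show ?thesis by (metis of_nat_add of_nat_le_iff of_nat_mult of_nat_numeral)
  qed
  then have "n * s \<le> n\<^sup>2 div 4 + s * s" by (simp add: power2_eq_square)
  moreover have "s * s \<ge> 1" using s by simp
  ultimately have "n * s \<le> schur_dim n + (s * s - 1)" unfolding schur_dim_def by linarith
  then have "?q ^ (n * s) \<le> ?q ^ schur_dim n * ?q ^ (s * s - 1)"
    using q by (metis power_add power_increasing less_imp_le)
  with main have "card A * ?q ^ (s * s - 1) \<le> ?q ^ schur_dim n * ?q ^ (s * s - 1)" by linarith
  then show ?thesis using q by simp
qed

end

section \<open>Commuting tuples\<close>

definition commutant :: "nat \<Rightarrow> 'a :: field mat set \<Rightarrow> 'a mat set" where
  "commutant n S = {a \<in> carrier_mat n n. \<forall>b\<in>S. a * b = b * a}"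

lemma commutant_carrier: "commutant n S \<subseteq> carrier_mat n n"
  by (auto simp: commutant_def)

lemma commutantD: "a \<in> commutant n S \<Longrightarrow> b \<in> S \<Longrightarrow> a * b = b * a"
  unfolding commutant_def by blast

lemma commutantI:
  "a \<in> carrier_mat n n \<Longrightarrow> (\<And>b. b \<in> S \<Longrightarrow> a * b = b * a) \<Longrightarrow> a \<in> commutant n S"
  unfolding commutant_def by blast

lemma subset_bicommutant: "S \<subseteq> carrier_mat n n \<Longrightarrow> S \<subseteq> commutant n (commutant n S)"
  unfolding commutant_def by auto

text \<open>Commutants reverse inclusions. A commuting set \<open>S\<close> lies in its commutant
  \<open>?T\<close>, so the bicommutant \<open>?A\<close> also lies in \<open>?T\<close>; as
  \<open>?A\<close> commutes with \<open>?T\<close>, it commutes with itself.\<close>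

lemma comm_mat_algebra_bicommutant:
  fixes S :: "'a :: {field, finite} mat set"
  assumes S: "S \<subseteq> carrier_mat n n" and comm: "\<And>a b. a \<in> S \<Longrightarrow> b \<in> S \<Longrightarrow> a * b = b * a"
  shows "comm_mat_algebra n (commutant n (commutant n S))"
proof
  let ?T = "commutant n S"
  let ?A = "commutant n ?T"
  have T: "t \<in> carrier_mat n n" if "t \<in> ?T" for t using that commutant_carrier by blast
  have A: "a \<in> carrier_mat n n" if "a \<in> ?A" for a using that commutant_carrier by blast
  show "?A \<subseteq> carrier_mat n n" by (rule commutant_carrier)
  show "1\<^sub>m n \<in> ?A" by (rule commutantI) (simp_all add: left_mult_one_mat[OF T] right_mult_one_mat[OF T])
  show "a + b \<in> ?A" if a: "a \<in> ?A" and b: "b \<in> ?A" for a b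
  proof (rule commutantI)
    show "a + b \<in> carrier_mat n n" using A[OF a] A[OF b] by simp
    show "(a + b) * t = t * (a + b)" if t: "t \<in> ?T" for t
      by (simp only: add_mult_distrib_mat[OF A[OF a] A[OF b] T[OF t]]
          mult_add_distrib_mat[OF T[OF t] A[OF a] A[OF b]] commutantD[OF a t] commutantD[OF b t])
  qed
  show "c \<cdot>\<^sub>m a \<in> ?A" if a: "a \<in> ?A" for a c
  proof (rule commutantI)
    show "c \<cdot>\<^sub>m a \<in> carrier_mat n n" using A[OF a] by simp
    show "c \<cdot>\<^sub>m a * t = t * (c \<cdot>\<^sub>m a)" if t: "t \<in> ?T" for t
      by (simp only: mult_smult_assoc_mat[OF A[OF a] T[OF t]]
          mult_smult_distrib[OF T[OF t] A[OF a]] commutantD[OF a t])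
  qed
  have "S \<subseteq> ?T" using S comm by (blast intro: commutantI)
  then have "?A \<subseteq> ?T" unfolding commutant_def by blast
  then show "a * b = b * a" if "a \<in> ?A" "b \<in> ?A" for a b
    using that commutantD by blast
qed

text \<open>Each tuple has all its entries in one instance of \<open>comm_mat_algebra\<close>. There
  are at most as many instances as sets of matrices, a number independent of \<open>k\<close>, and
  each contributes at most the \<open>k\<close>-th power of Schur's bound.\<close>

lemma card_commuting_tuples_le:
  fixes n k :: nat
  assumes "n \<ge> 1"
  shows "card (commuting_tuples TYPE('a :: {field, finite}) n k)
    \<le> 2 ^ card (carrier_mat n n :: 'a mat set) * CARD('a) ^ (schur_dim n * k)"
proof -
  define \<A> where "\<A> = {A :: 'a mat set. comm_mat_algebra n A}"
  let ?L = "\<lambda>A :: 'a mat set. {As. set As \<subseteq> A \<and> length As = k}"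
  have sub: "\<A> \<subseteq> Pow (carrier_mat n n)"
    using comm_mat_algebra.carrier by (auto simp: \<A>_def)
  have fin: "finite \<A>" by (rule finite_subset[OF sub]) (simp add: finite_carrier_mat)
  have finA: "finite A" if "A \<in> \<A>" for A
    using that sub finite_carrier_mat finite_subset by blast
  have "commuting_tuples TYPE('a) n k \<subseteq> (\<Union>A\<in>\<A>. ?L A)"
  proof
    fix As assume As: "As \<in> commuting_tuples TYPE('a) n k"
    have car: "set As \<subseteq> carrier_mat n n" and len: "length As = k"
      using As by (auto simp: commuting_tuples_def)
    \<comment> \<open>The tuples commute by definition only at distinct indices; at equal indices
      the two matrices coincide.\<close>
    have comm: "a * b = b * a" if "a \<in> set As" "b \<in> set As" for a b
      using As that by (auto simp: commuting_tuples_def in_set_conv_nth)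
    have "commutant n (commutant n (set As)) \<in> \<A>"
      using comm_mat_algebra_bicommutant[OF car comm] by (simp add: \<A>_def)
    moreover have "set As \<subseteq> commutant n (commutant n (set As))"
      by (rule subset_bicommutant[OF car])
    ultimately show "As \<in> (\<Union>A\<in>\<A>. ?L A)" using len by blast
  qed
  then have "card (commuting_tuples TYPE('a) n k) \<le> card (\<Union>A\<in>\<A>. ?L A)"
    by (rule card_mono[rotated]) (simp add: fin finA finite_lists_length_eq)
  also have "\<dots> \<le> (\<Sum>A\<in>\<A>. card (?L A))" by (rule card_UN_le[OF fin])
  also have "\<dots> \<le> (\<Sum>A\<in>\<A>. CARD('a) ^ (schur_dim n * k))"
  proof (rule sum_mono)
    fix A assume A: "A \<in> \<A>"
    then have "card A \<le> CARD('a) ^ schur_dim n"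
      using comm_mat_algebra.card_le assms by (auto simp: \<A>_def)
    then show "card (?L A) \<le> CARD('a) ^ (schur_dim n * k)"
      by (simp add: card_lists_length_eq[OF finA[OF A]] power_mult power_mono)
  qed
  also have "\<dots> = card \<A> * CARD('a) ^ (schur_dim n * k)" by simp
  also have "card \<A> \<le> card (Pow (carrier_mat n n :: 'a mat set))"
    by (rule card_mono[OF _ sub]) (simp add: finite_carrier_mat)
  then have "card \<A> * CARD('a) ^ (schur_dim n * k)
      \<le> 2 ^ card (carrier_mat n n :: 'a mat set) * CARD('a) ^ (schur_dim n * k)"
    by (simp add: card_Pow finite_carrier_mat)
  finally show ?thesis .
qed

section \<open>A commuting set of matrices that attains Schur's bound\<close>

definition block_mat :: "nat \<Rightarrow> (nat \<times> nat \<Rightarrow> 'a) \<Rightarrow> 'a :: field mat" where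
  "block_mat n f = mat n n (\<lambda>(i, j). if i < n div 2 \<and> n div 2 \<le> j then f (i, j) else 0)"

definition scalar_block_mat :: "nat \<Rightarrow> 'a \<times> (nat \<times> nat \<Rightarrow> 'a) \<Rightarrow> 'a :: field mat" where
  "scalar_block_mat n = (\<lambda>(c, f). c \<cdot>\<^sub>m 1\<^sub>m n + block_mat n f)"

lemma scalar_block_mat_commute:
  "scalar_block_mat n x * scalar_block_mat n y = scalar_block_mat n y * scalar_block_mat n x"
proof -
  obtain c f d g where xy: "x = (c, f)" "y = (d, g)" by fastforce
  have car [simp]: "block_mat n h \<in> carrier_mat n n" for h :: "nat \<times> nat \<Rightarrow> 'a"
    by (simp add: block_mat_def)
  have dims [simp]: "dim_row (block_mat n h) = n" "dim_col (block_mat n h) = n"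
    for h :: "nat \<times> nat \<Rightarrow> 'a"
    by (simp_all add: block_mat_def)
  \<comment> \<open>A nonzero summand would need a middle index both below \<open>n div 2\<close>
    and at least \<open>n div 2\<close>.\<close>
  have null: "block_mat n h * block_mat n h' = 0\<^sub>m n n" for h h' :: "nat \<times> nat \<Rightarrow> 'a"
    by (rule eq_matI) (auto simp: block_mat_def scalar_prod_def intro!: sum.neutral)
  \<comment> \<open>With the product of the blocks gone, the result is unchanged when the two
    factors are swapped.\<close>
  have e: "(c \<cdot>\<^sub>m 1\<^sub>m n + block_mat n f) * (d \<cdot>\<^sub>m 1\<^sub>m n + block_mat n g)
      = ((c * d) \<cdot>\<^sub>m 1\<^sub>m n + c \<cdot>\<^sub>m block_mat n g) + d \<cdot>\<^sub>m block_mat n f"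
    for c d and f g :: "nat \<times> nat \<Rightarrow> 'a"
    by (simp add: add_mult_distrib_mat[of _ n n _ _ n] mult_add_distrib_mat[of _ n n _ n] null
        left_mult_one_mat[of _ n n] right_mult_one_mat[of _ n n]
        mult_smult_assoc_mat[of _ n n _ n] mult_smult_distrib[of _ n n _ n])
      (auto intro!: eq_matI simp: algebra_simps)
  show ?thesis unfolding scalar_block_mat_def xy prod.case e
    by (intro eq_matI) (auto simp: block_mat_def algebra_simps)
qed

text \<open>The left side is the number of free entries of the off-diagonal block; together with the
  scalar they make up the exponent \<open>schur_dim n\<close>.\<close>

lemma half_times_half: "n div 2 * (n - n div 2) = n\<^sup>2 div (4 :: nat)"
proof (cases "even n")
  case True
  then obtain m where "n = 2 * m" by blast
  then show ?thesis by (simp add: power2_eq_square)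
next
  case False
  then obtain m where m: "n = 2 * m + 1" using oddE by blast
  have "n\<^sup>2 = 4 * (m * (m + 1)) + 1" by (simp add: m power2_eq_square algebra_simps)
  then have "n\<^sup>2 div 4 = m * (m + 1)" by simp
  then show ?thesis by (simp add: m)
qed

lemma card_commuting_tuples_ge:
  fixes n k :: nat
  assumes n: "n \<ge> 1"
  shows "CARD('a) ^ (schur_dim n * k) \<le> card (commuting_tuples TYPE('a :: {field, finite}) n k)"
proof -
  \<comment> \<open>Only the values of \<open>f\<close> on the block enter the matrix, so
    \<open>f\<close> is taken extensional there to make the parametrization injective.\<close>
  define X where "X = (UNIV :: 'a set) \<times>
    (({..<n div 2} \<times> {n div 2..<n}) \<rightarrow>\<^sub>E (UNIV :: 'a set))"
  let ?L = "scalar_block_mat n ` X"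
  have finX: "finite X" by (auto simp: X_def intro!: finite_PiE)
  have "inj_on (scalar_block_mat n) X"
  proof (rule inj_onI)
    fix x y assume x: "x \<in> X" and y: "y \<in> X" and eq: "scalar_block_mat n x = scalar_block_mat n y"
    obtain c f d g where xy: "x = (c, f)" "y = (d, g)" by fastforce
    have ent: "(if i = j then c else 0) + (if i < n div 2 \<and> n div 2 \<le> j then f (i, j) else 0)
        = (if i = j then d else 0) + (if i < n div 2 \<and> n div 2 \<le> j then g (i, j) else 0)"
      if "i < n" "j < n" for i j
      using arg_cong[OF eq, of "\<lambda>m. m $$ (i, j)"] that
      by (auto simp: xy scalar_block_mat_def block_mat_def split: if_splits)
    \<comment> \<open>The entry at \<open>(0, 0)\<close> exists as \<open>n\<close> is positive and
      lies outside the block, so it shows the scalar alone.\<close>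
    have "c = d" using ent[of 0 0] n by (simp split: if_splits)
    moreover have "f = g"
    proof (rule PiE_ext)
      show "f \<in> ({..<n div 2} \<times> {n div 2..<n}) \<rightarrow>\<^sub>E UNIV"
        "g \<in> ({..<n div 2} \<times> {n div 2..<n}) \<rightarrow>\<^sub>E UNIV"
        using x y by (auto simp: X_def xy)
      show "f p = g p" if "p \<in> {..<n div 2} \<times> {n div 2..<n}" for p
        using that ent[of "fst p" "snd p"] by auto
    qed
    ultimately show "x = y" by (simp add: xy)
  qed
  then have "card ?L = card X" by (rule card_image)
  also have "\<dots> = CARD('a) ^ schur_dim n"
    using half_times_half[of n]
    by (simp add: X_def card_cartesian_product card_PiE schur_dim_def)
  finally have L: "card ?L = CARD('a) ^ schur_dim n" .
  have "{As. set As \<subseteq> ?L \<and> length As = k} \<subseteq> commuting_tuples TYPE('a) n k"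
  proof clarify
    fix As assume As: "set As \<subseteq> ?L" and k: "k = length As"
    have "?L \<subseteq> carrier_mat n n" by (auto simp: scalar_block_mat_def block_mat_def)
    moreover have "As ! i * As ! j = As ! j * As ! i" if "i < length As" "j < length As" for i j
    proof -
      have "As ! i \<in> ?L" "As ! j \<in> ?L" using As that nth_mem by blast+
      then obtain x y where "As ! i = scalar_block_mat n x" "As ! j = scalar_block_mat n y"
        by (elim imageE)
      then show ?thesis using scalar_block_mat_commute[of n x y] by (simp only:)
    qed
    ultimately show "As \<in> commuting_tuples TYPE('a) n (length As)"
      using As unfolding commuting_tuples_def by blast
  qed
  then have "card {As. set As \<subseteq> ?L \<and> length As = k} \<le> card (commuting_tuples TYPE('a) n k)"
    by (rule card_mono[OF finite_commuting_tuples])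
  then show ?thesis
    by (simp add: card_lists_length_eq finX L power_mult)
qed

section \<open>Orbits\<close>

lemma card_orbits_le:
  assumes "finite E"
  shows "card (orbits G E \<phi>) \<le> card E"
proof -
  have "orbits G E \<phi> = orbit G \<phi> ` E" by (auto simp: orbits_def)
  then show ?thesis using assms by (simp add: card_image_le)
qed

text \<open>The orbits cover \<open>E\<close>, and each is an image of the group.\<close>

lemma (in group_action) card_le_orbits:
  assumes G: "finite (carrier G)" and E: "finite E"
  shows "card E \<le> card (orbits G E \<phi>) * card (carrier G)"
proof -
  have "card E = card (\<Union>(orbits G E \<phi>))" by (simp add: orbits_coverture)
  also have "\<dots> \<le> (\<Sum>X\<in>orbits G E \<phi>. card X)"
    using card_UN_le[of "orbits G E \<phi>" "\<lambda>x. x"] E by (simp add: orbits_def)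
  also have "\<dots> \<le> (\<Sum>X\<in>orbits G E \<phi>. card (carrier G))"
  proof (rule sum_mono)
    fix X assume "X \<in> orbits G E \<phi>"
    then obtain x where "X = (\<lambda>g. (\<phi> g) x) ` carrier G"
      by (auto simp: orbits_def orbit_def)
    then show "card X \<le> card (carrier G)" using G by (simp add: card_image_le)
  qed
  finally show ?thesis by simp
qed

theorem theorem1:
  fixes n q :: nat
  assumes "n \<ge> 1" and "q = CARD('a :: {field, finite})"
  shows "\<exists>C1 C2 :: real. C1 > 0 \<and> C2 > 0 \<and>
    (\<forall>\<^sub>F k in sequentially.
       C1 * real q ^ (schur_dim n * k) \<le> real (num_orbits TYPE('a) n k) \<and>
       real (num_orbits TYPE('a) n k) \<le> C2 * real q ^ (schur_dim n * k))"
proof -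
  let ?G = "GL TYPE('a) n"
  let ?g = "card (carrier ?G)" and ?N = "2 ^ card (carrier_mat n n :: 'a mat set) :: nat"
  have finG: "finite (carrier ?G)"
    by (rule finite_subset[OF _ finite_carrier_mat[of n n]]) (auto intro: carrier_GL)
  interpret G: group ?G by (rule group_GL)
  have g: "?g > 0" using finG G.one_closed by (auto simp: card_gt_0_iff)
  \<comment> \<open>Both bounds hold for every \<open>k\<close>. The lower constant is the inverse
    of the group order, the upper one the number of sets of matrices.\<close>
  have "1 / real ?g * real q ^ (schur_dim n * k) \<le> real (num_orbits TYPE('a) n k) \<and>
      real (num_orbits TYPE('a) n k) \<le> real ?N * real q ^ (schur_dim n * k)" for k
  proof
    let ?E = "commuting_tuples TYPE('a) n k"
    interpret act: group_action ?G ?E "sim_conj TYPE('a) n k"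
      by (rule group_action_sim_conj)
    have "q ^ (schur_dim n * k) \<le> card ?E"
      using card_commuting_tuples_ge[OF assms(1), where 'a = 'a] assms(2) by simp
    also have "\<dots> \<le> num_orbits TYPE('a) n k * ?g"
      unfolding num_orbits_def by (rule act.card_le_orbits[OF finG finite_commuting_tuples])
    finally have "real (q ^ (schur_dim n * k)) \<le> real (num_orbits TYPE('a) n k * ?g)"
      by (rule of_nat_mono)
    then show "1 / real ?g * real q ^ (schur_dim n * k) \<le> real (num_orbits TYPE('a) n k)"
      using g by (simp add: field_simps)
    have "num_orbits TYPE('a) n k \<le> card ?E"
      unfolding num_orbits_def by (rule card_orbits_le[OF finite_commuting_tuples])
    also have "\<dots> \<le> ?N * q ^ (schur_dim n * k)"
      using card_commuting_tuples_le[OF assms(1), where 'a = 'a] assms(2) by simp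
    finally have "real (num_orbits TYPE('a) n k) \<le> real (?N * q ^ (schur_dim n * k))"
      by (rule of_nat_mono)
    then show "real (num_orbits TYPE('a) n k) \<le> real ?N * real q ^ (schur_dim n * k)" by simp
  qed
  moreover have "1 / real ?g > 0" "real ?N > 0" using g by simp_all
  ultimately show ?thesis by (intro exI[of _ "1 / real ?g"] exI[of _ "real ?N"]) simp
qed

end
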